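(* Let $C$ be a commutative ring, $R$ a $C$-algebra, $G$ a semigroup (with zero), and $\delta : G \to R$ a central map that preserves zero. Then the map $t_\delta : \overline{CG} \to R$ given by $t_\delta\big(\sum_g a_g g\big) = \sum_g a_g\delta(g)$ is a $C$-linear trace. Moreover, if $C$ is unital, then every $C$-linear trace $t: \overline{CG} \to R$ is of this form, i.e., $t=t_\delta$ for some central map $\delta: G \to R$ that preserves zero.
   Context: Rings are associative but not necessarily unital. If $C$ is unital, $C$-algebras are assumed to have $1\in C$ acting as the identity. "Semigroup" means a semigroup with zero. For a semigroup $G$ with zero $0_G$, $\overline{CG}$ denotes the contracted semigroup ring $CG/\{x\cdot 0_G \mid x\in C\}$, i.e., the semigroup ring $CG$ with the zero of $G$ identified with the zero of the ring; its elements are written $\sum_g a_g g$, where $g$ ranges over the nonzero elements of $G$, $a_g\in C$, and all but finitely many $a_g$ are zero. A map $\delta: G\to R$ preserves zero if $\delta(0)=0$, and is central if $\delta(gh)=\delta(hg)$ for all $g,h\in G$. For rings $A$ and $T$, a ($T$-valued) trace on $A$ is a map $t:A\to T$ with $t(x+y)=t(x)+t(y)$ and $t(xy)=t(yx)$ for all $x,y\in A$. If $A,T$ are $C$-algebras, $t$ is $C$-linear if $t(cx)=ct(x)$ for all $c\in C$, $x\in A$. *)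

theory Defs
  imports Main
begin

text \<open>
  Rings are the type class \<open>ring\<close>, which does not demand a unit. A unit of the coefficient ring
  is expressed by \<open>is_unity\<close> rather than by \<open>comm_ring_1\<close>, because the latter excludes the zero
  ring and cannot be assumed in only a part of a statement. Semigroups with zero are types of sort
  \<open>{semigroup_mult,mult_zero}\<close>.
\<close>

definition is_unity :: "'c::ring \<Rightarrow> bool" where
  "is_unity e \<longleftrightarrow> (\<forall>c. e * c = c \<and> c * e = c)"

text \<open>The library locales for modules and algebras require unital rings.\<close>

locale algebra_over =
  fixes scale :: "'c::comm_ring \<Rightarrow> 'r::ring \<Rightarrow> 'r"
  assumes scale_add_left: "scale (c + d) x = scale c x + scale d x"
    and scale_add_right: "scale c (x + y) = scale c x + scale c y"
    and scale_scale: "scale c (scale d x) = scale (c * d) x"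
    and scale_mult_left: "scale c (x * y) = scale c x * y"
    and scale_mult_right: "scale c (x * y) = x * scale c y"
    and scale_unity: "is_unity e \<Longrightarrow> scale e x = x"

definition is_trace :: "('a::ring \<Rightarrow> 't::ring) \<Rightarrow> bool" where
  "is_trace t \<longleftrightarrow> (\<forall>x y. t (x + y) = t x + t y) \<and> (\<forall>x y. t (x * y) = t (y * x))"

definition scale_linear :: "('c \<Rightarrow> 'a \<Rightarrow> 'a) \<Rightarrow> ('c \<Rightarrow> 't \<Rightarrow> 't) \<Rightarrow> ('a \<Rightarrow> 't) \<Rightarrow> bool" where
  "scale_linear scaleA scaleT t \<longleftrightarrow> (\<forall>c x. t (scaleA c x) = scaleT c (t x))"

definition preserves_zero :: "('g::zero \<Rightarrow> 'r::zero) \<Rightarrow> bool" where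
  "preserves_zero \<delta> \<longleftrightarrow> \<delta> 0 = 0"

definition is_central :: "('g::times \<Rightarrow> 'r) \<Rightarrow> bool" where
  "is_central \<delta> \<longleftrightarrow> (\<forall>g h. \<delta> (g * h) = \<delta> (h * g))"


section \<open>Semigroup rings\<close>

typedef (overloaded) ('c, 'g) semigroup_ring = "{f :: 'g \<Rightarrow> 'c::zero. finite {g. f g \<noteq> 0}}"
  morphisms coeff Abs_semigroup_ring
  by (rule exI[of _ "\<lambda>_. 0"]) simp

setup_lifting type_definition_semigroup_ring

lemma finite_coeff: "finite {g. coeff f g \<noteq> 0}"
  using coeff[of f] by simp

lemma semigroup_ring_eqI: "(\<And>g. coeff f g = coeff h g) \<Longrightarrow> f = h"
  by (simp add: coeff_inject[symmetric] fun_eq_iff)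

lift_definition monomial :: "'c::zero \<Rightarrow> 'g \<Rightarrow> ('c, 'g) semigroup_ring" is
  "\<lambda>c g k. if k = g then c else 0"
  by (rule finite_subset[of _ "{g}" for g]) auto

instantiation semigroup_ring :: (ring, type) ab_group_add
begin

lift_definition zero_semigroup_ring :: "('a, 'b) semigroup_ring" is "\<lambda>_. 0" by simp

lift_definition plus_semigroup_ring ::
  "('a, 'b) semigroup_ring \<Rightarrow> ('a, 'b) semigroup_ring \<Rightarrow> ('a, 'b) semigroup_ring" is
  "\<lambda>f h g. f g + h g"
  subgoal for f h by (rule finite_subset[of _ "{g. f g \<noteq> 0} \<union> {g. h g \<noteq> 0}"]) auto
  done

lift_definition minus_semigroup_ring ::
  "('a, 'b) semigroup_ring \<Rightarrow> ('a, 'b) semigroup_ring \<Rightarrow> ('a, 'b) semigroup_ring" is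
  "\<lambda>f h g. f g - h g"
  subgoal for f h by (rule finite_subset[of _ "{g. f g \<noteq> 0} \<union> {g. h g \<noteq> 0}"]) auto
  done

lift_definition uminus_semigroup_ring :: "('a, 'b) semigroup_ring \<Rightarrow> ('a, 'b) semigroup_ring" is
  "\<lambda>f g. - f g"
  by simp

instance
  by (intro_classes; transfer) (auto simp: fun_eq_iff)

end

definition mult_coeff :: "('g::times \<Rightarrow> 'c::ring) \<Rightarrow> ('g \<Rightarrow> 'c) \<Rightarrow> 'g \<Rightarrow> 'c" where
  "mult_coeff f h k = (\<Sum>(a, b) \<in> {(a, b). f a \<noteq> 0 \<and> h b \<noteq> 0 \<and> a * b = k}. f a * h b)"

lemma mult_coeff_eq:
  assumes "finite A" "finite B" "{g. f g \<noteq> 0} \<subseteq> A" "{g. h g \<noteq> 0} \<subseteq> B"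
  shows "mult_coeff f h k = (\<Sum>a\<in>A. \<Sum>b\<in>B. if a * b = k then f a * h b else 0)"
proof -
  have "(\<Sum>a\<in>A. \<Sum>b\<in>B. if a * b = k then f a * h b else 0)
      = (\<Sum>(a, b) \<in> A \<times> B. if a * b = k then f a * h b else 0)"
    by (simp add: sum.cartesian_product)
  also have "\<dots> = mult_coeff f h k"
    unfolding mult_coeff_def using assms
    by (intro sum.mono_neutral_cong_right) (auto split: if_splits)
  finally show ?thesis by simp
qed

lemma mult_coeff_supp:
  "{k. mult_coeff f h k \<noteq> 0} \<subseteq> (\<lambda>(a, b). a * b) ` ({a. f a \<noteq> 0} \<times> {b. h b \<noteq> 0})"
proof
  fix k assume "k \<in> {k. mult_coeff f h k \<noteq> 0}"
  then have "{(a, b). f a \<noteq> 0 \<and> h b \<noteq> 0 \<and> a * b = k} \<noteq> {}"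
    unfolding mult_coeff_def by (intro notI) simp
  then show "k \<in> (\<lambda>(a, b). a * b) ` ({a. f a \<noteq> 0} \<times> {b. h b \<noteq> 0})"
    by auto
qed

instantiation semigroup_ring :: (ring, semigroup_mult) ring
begin

lift_definition times_semigroup_ring ::
  "('a, 'b) semigroup_ring \<Rightarrow> ('a, 'b) semigroup_ring \<Rightarrow> ('a, 'b) semigroup_ring" is mult_coeff
  by (rule finite_subset[OF mult_coeff_supp]) simp

lemma coeff_mult_eq:
  fixes f h :: "('a, 'b) semigroup_ring"
  assumes "finite A" "finite B" "{g. coeff f g \<noteq> 0} \<subseteq> A" "{g. coeff h g \<noteq> 0} \<subseteq> B"
  shows "coeff (f * h) k = (\<Sum>a\<in>A. \<Sum>b\<in>B. if a * b = k then coeff f a * coeff h b else 0)"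
  using mult_coeff_eq[OF assms] by (simp add: times_semigroup_ring.rep_eq)

instance
proof
  fix x y z :: "('a, 'b) semigroup_ring"
  define A where "A = {g. coeff x g \<noteq> 0} \<union> {g. coeff y g \<noteq> 0} \<union> {g. coeff z g \<noteq> 0}"
  have A: "finite A" "{g. coeff x g \<noteq> 0} \<subseteq> A" "{g. coeff y g \<noteq> 0} \<subseteq> A" "{g. coeff z g \<noteq> 0} \<subseteq> A"
    by (auto simp: A_def finite_coeff)
  have xy: "{g. coeff (x + y) g \<noteq> 0} \<subseteq> A" and yz: "{g. coeff (y + z) g \<noteq> 0} \<subseteq> A"
    using A by (auto simp: plus_semigroup_ring.rep_eq A_def)
  show "(x + y) * z = x * z + y * z"
    by (rule semigroup_ring_eqI)
      (simp add: coeff_mult_eq[OF A(1) A(1) xy A(4)] coeff_mult_eq[OF A(1) A(1) A(2) A(4)]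
        coeff_mult_eq[OF A(1) A(1) A(3) A(4)] plus_semigroup_ring.rep_eq
        sum.distrib[symmetric] if_distrib distrib_right cong: if_cong)
  show "x * (y + z) = x * y + x * z"
    by (rule semigroup_ring_eqI)
      (simp add: coeff_mult_eq[OF A(1) A(1) A(2) yz] coeff_mult_eq[OF A(1) A(1) A(2) A(3)]
        coeff_mult_eq[OF A(1) A(1) A(2) A(4)] plus_semigroup_ring.rep_eq
        sum.distrib[symmetric] if_distrib distrib_left cong: if_cong)
  define M where "M = (\<lambda>(a, b). a * b) ` (A \<times> A)"
  have M: "finite M" "\<And>a b. a \<in> A \<Longrightarrow> b \<in> A \<Longrightarrow> a * b \<in> M"
    using A(1) by (auto simp: M_def)
  have Mxy: "{g. coeff (x * y) g \<noteq> 0} \<subseteq> M" and Myz: "{g. coeff (y * z) g \<noteq> 0} \<subseteq> M"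
    using mult_coeff_supp[of "coeff x" "coeff y"] mult_coeff_supp[of "coeff y" "coeff z"] A
    unfolding M_def times_semigroup_ring.rep_eq by blast+
  show "x * y * z = x * (y * z)"
  proof (rule semigroup_ring_eqI)
    fix k
    have "coeff (x * y * z) k = (\<Sum>m\<in>M. \<Sum>d\<in>A. \<Sum>a\<in>A. \<Sum>b\<in>A.
        if a * b = m then if m * d = k then coeff x a * coeff y b * coeff z d else 0 else 0)"
      by (simp add: coeff_mult_eq[OF M(1) A(1) Mxy A(4)] coeff_mult_eq[OF A(1) A(1) A(2) A(3)]
          sum_distrib_right if_distrib[of "\<lambda>u. u * _"] cong: if_cong)
        (intro sum.cong refl, simp cong: if_cong)
    also have "\<dots> = (\<Sum>d\<in>A. \<Sum>a\<in>A. \<Sum>b\<in>A. \<Sum>m\<in>M.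
        if a * b = m then if m * d = k then coeff x a * coeff y b * coeff z d else 0 else 0)"
      by (simp add: sum.swap[of _ _ M])
    also have "\<dots> = (\<Sum>d\<in>A. \<Sum>a\<in>A. \<Sum>b\<in>A.
        if a * b * d = k then coeff x a * coeff y b * coeff z d else 0)"
      by (intro sum.cong refl) (simp add: sum.delta M)
    also have "\<dots> = (\<Sum>a\<in>A. \<Sum>d\<in>A. \<Sum>b\<in>A.
        if a * b * d = k then coeff x a * coeff y b * coeff z d else 0)"
      by (rule sum.swap)
    also have "\<dots> = (\<Sum>a\<in>A. \<Sum>b\<in>A. \<Sum>d\<in>A.
        if a * b * d = k then coeff x a * coeff y b * coeff z d else 0)"
      by (intro sum.cong[OF refl] sum.swap)
    also have "\<dots> = (\<Sum>a\<in>A. \<Sum>b\<in>A. \<Sum>d\<in>A.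
        if a * (b * d) = k then coeff x a * (coeff y b * coeff z d) else 0)"
      by (simp add: mult.assoc cong: if_cong)
    also have "\<dots> = (\<Sum>a\<in>A. \<Sum>b\<in>A. \<Sum>d\<in>A. \<Sum>m\<in>M.
        if b * d = m then if a * m = k then coeff x a * (coeff y b * coeff z d) else 0 else 0)"
      by (intro sum.cong refl) (simp add: sum.delta M)
    also have "\<dots> = (\<Sum>a\<in>A. \<Sum>m\<in>M. \<Sum>b\<in>A. \<Sum>d\<in>A.
        if b * d = m then if a * m = k then coeff x a * (coeff y b * coeff z d) else 0 else 0)"
      by (simp add: sum.swap[of _ M])
    also have "\<dots> = coeff (x * (y * z)) k"
      by (simp add: coeff_mult_eq[OF A(1) M(1) A(2) Myz] coeff_mult_eq[OF A(1) A(1) A(3) A(4)]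
          sum_distrib_left if_distrib[of "\<lambda>u. _ * u"] cong: if_cong)
        (intro sum.cong refl, simp cong: if_cong)
    finally show "coeff (x * y * z) k = coeff (x * (y * z)) k" .
  qed
qed

end

lift_definition sr_scale ::
  "'c::comm_ring \<Rightarrow> ('c, 'g) semigroup_ring \<Rightarrow> ('c, 'g) semigroup_ring" is
  "\<lambda>c f g. c * f g"
  by (erule finite_subset[rotated]) auto


section \<open>Contracted semigroup rings\<close>

definition contract_rel ::
  "('c::ring, 'g::zero) semigroup_ring \<Rightarrow> ('c, 'g) semigroup_ring \<Rightarrow> bool" where
  "contract_rel f h \<longleftrightarrow> f - h \<in> {monomial c 0 | c. True}"

lemma contract_rel_iff: "contract_rel f h \<longleftrightarrow> (\<forall>g. g \<noteq> 0 \<longrightarrow> coeff f g = coeff h g)"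
proof
  assume "contract_rel f h"
  then obtain c where "f - h = monomial c 0"
    by (auto simp: contract_rel_def)
  then have "coeff f g - coeff h g = coeff (monomial c 0) g" for g
    by (metis minus_semigroup_ring.rep_eq)
  then have "coeff f g - coeff h g = 0" if "g \<noteq> 0" for g
    using that by (simp add: monomial.rep_eq)
  then show "\<forall>g. g \<noteq> 0 \<longrightarrow> coeff f g = coeff h g"
    by simp
next
  assume "\<forall>g. g \<noteq> 0 \<longrightarrow> coeff f g = coeff h g"
  then have "f - h = monomial (coeff f 0 - coeff h 0) 0"
    by (intro semigroup_ring_eqI) (simp add: minus_semigroup_ring.rep_eq monomial.rep_eq)
  then show "contract_rel f h"
    by (auto simp: contract_rel_def)
qed

quotient_type (overloaded) ('c, 'g) contracted_ring =
  "('c::ring, 'g::zero) semigroup_ring" / contract_rel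
  by (auto intro!: equivpI reflpI sympI transpI simp: contract_rel_iff)

instantiation contracted_ring :: (ring, zero) ab_group_add
begin

lift_definition zero_contracted_ring :: "('a, 'b) contracted_ring" is 0 .

lift_definition plus_contracted_ring ::
  "('a, 'b) contracted_ring \<Rightarrow> ('a, 'b) contracted_ring \<Rightarrow> ('a, 'b) contracted_ring" is "(+)"
  by (simp add: contract_rel_iff plus_semigroup_ring.rep_eq)

lift_definition minus_contracted_ring ::
  "('a, 'b) contracted_ring \<Rightarrow> ('a, 'b) contracted_ring \<Rightarrow> ('a, 'b) contracted_ring" is "(-)"
  by (simp add: contract_rel_iff minus_semigroup_ring.rep_eq)

lift_definition uminus_contracted_ring ::
  "('a, 'b) contracted_ring \<Rightarrow> ('a, 'b) contracted_ring" is uminus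
  by (simp add: contract_rel_iff uminus_semigroup_ring.rep_eq)

instance
  by (intro_classes; transfer) (auto simp: contract_rel_iff algebra_simps)

end

lemma contract_rel_mult:
  fixes f h f' h' :: "('c::ring, 'g::{semigroup_mult,mult_zero}) semigroup_ring"
  assumes "contract_rel f f'" "contract_rel h h'"
  shows "contract_rel (f * h) (f' * h')"
  unfolding contract_rel_iff
proof (intro allI impI)
  fix k :: 'g assume k: "k \<noteq> 0"
  have *: "{(a, b). coeff f a \<noteq> 0 \<and> coeff h b \<noteq> 0 \<and> a * b = k}
      = {(a, b). coeff f' a \<noteq> 0 \<and> coeff h' b \<noteq> 0 \<and> a * b = k}"
    using assms k unfolding contract_rel_iff by (auto, (metis mult_zero_left mult_zero_right)+)
  show "coeff (f * h) k = coeff (f' * h') k"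
    unfolding times_semigroup_ring.rep_eq mult_coeff_def *
    using assms k unfolding contract_rel_iff
    by (intro sum.cong refl) (clarsimp, metis mult_zero_left mult_zero_right)
qed

instantiation contracted_ring :: (ring, "{semigroup_mult,mult_zero}") ring
begin

lift_definition times_contracted_ring ::
  "('a, 'b) contracted_ring \<Rightarrow> ('a, 'b) contracted_ring \<Rightarrow> ('a, 'b) contracted_ring" is "(*)"
  by (rule contract_rel_mult)

instance
  by (intro_classes; transfer) (auto simp: contract_rel_iff algebra_simps)

end

lift_definition cr_scale ::
  "'c::comm_ring \<Rightarrow> ('c, 'g::zero) contracted_ring \<Rightarrow> ('c, 'g) contracted_ring" is sr_scale
  by (simp add: contract_rel_iff sr_scale.rep_eq)

lemma mult_coeff_scale:
  "mult_coeff (\<lambda>g. c * f g) h k = c * mult_coeff f h k"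
  "mult_coeff f (\<lambda>g. c * h g) k = c * mult_coeff f h k"
  if "finite {g. f g \<noteq> 0}" "finite {g. h g \<noteq> 0}" for c :: "'c::comm_ring"
proof -
  have 1: "{g. c * f g \<noteq> 0} \<subseteq> {g. f g \<noteq> 0}" and 2: "{g. c * h g \<noteq> 0} \<subseteq> {g. h g \<noteq> 0}"
    by auto
  show "mult_coeff (\<lambda>g. c * f g) h k = c * mult_coeff f h k"
    unfolding mult_coeff_eq[OF that 1 order_refl] mult_coeff_eq[OF that order_refl order_refl]
    by (auto simp: sum_distrib_left mult.assoc intro!: sum.cong)
  show "mult_coeff f (\<lambda>g. c * h g) k = c * mult_coeff f h k"
    unfolding mult_coeff_eq[OF that order_refl 2] mult_coeff_eq[OF that order_refl order_refl]
    by (auto simp: sum_distrib_left mult.left_commute intro!: sum.cong)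
qed

lemma algebra_over_cr_scale:
  "algebra_over (cr_scale :: 'c::comm_ring \<Rightarrow> ('c, 'g::{semigroup_mult,mult_zero}) contracted_ring \<Rightarrow> _)"
proof
  fix c d e :: 'c and x y :: "('c, 'g) contracted_ring"
  show "cr_scale (c + d) x = cr_scale c x + cr_scale d x"
    by transfer (simp add: contract_rel_iff sr_scale.rep_eq plus_semigroup_ring.rep_eq distrib_right)
  show "cr_scale c (x + y) = cr_scale c x + cr_scale c y"
    by transfer (simp add: contract_rel_iff sr_scale.rep_eq plus_semigroup_ring.rep_eq distrib_left)
  show "cr_scale c (cr_scale d x) = cr_scale (c * d) x"
    by transfer (simp add: contract_rel_iff sr_scale.rep_eq mult.assoc)
  show "cr_scale c (x * y) = cr_scale c x * y"
    by transfer (simp add: contract_rel_iff sr_scale.rep_eq times_semigroup_ring.rep_eq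
        mult_coeff_scale finite_coeff)
  show "cr_scale c (x * y) = x * cr_scale c y"
    by transfer (simp add: contract_rel_iff sr_scale.rep_eq times_semigroup_ring.rep_eq
        mult_coeff_scale finite_coeff)
  show "cr_scale e x = x" if "is_unity e"
    using that by transfer (simp add: contract_rel_iff sr_scale.rep_eq is_unity_def)
qed

text \<open>
  The elements of the contracted ring are written uniquely as finite sums of monomials \<open>a g\<close> with
  \<open>g \<noteq> 0\<close>; \<open>cr_coeff x g\<close> is the coefficient of \<open>g\<close> in this expansion, so that it vanishes at
  \<open>g = 0\<close>.
\<close>

lift_definition cr_monomial :: "'c::ring \<Rightarrow> 'g::zero \<Rightarrow> ('c, 'g) contracted_ring" is monomial .

lift_definition cr_coeff :: "('c::ring, 'g::zero) contracted_ring \<Rightarrow> 'g \<Rightarrow> 'c" is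
  "\<lambda>f g. if g = 0 then 0 else coeff f g"
  by (auto simp: contract_rel_iff)

lemma finite_cr_coeff: "finite {g. cr_coeff x g \<noteq> 0}"
  by transfer (rule finite_subset[OF _ finite_coeff], auto)

lemma cr_coeff_inject: "cr_coeff x = cr_coeff y \<longleftrightarrow> x = y"
  by transfer (auto simp: contract_rel_iff fun_eq_iff)

lemma cr_coeff_zero: "cr_coeff 0 g = 0"
  by transfer (simp add: zero_semigroup_ring.rep_eq)

lemma cr_coeff_add: "cr_coeff (x + y) g = cr_coeff x g + cr_coeff y g"
  by transfer (simp add: plus_semigroup_ring.rep_eq)

lemma cr_coeff_monomial: "cr_coeff (cr_monomial c g) k = (if k = g \<and> k \<noteq> 0 then c else 0)"
  by transfer (simp add: monomial.rep_eq)

lemma cr_coeff_sum: "cr_coeff (\<Sum>i\<in>I. x i) g = (\<Sum>i\<in>I. cr_coeff (x i) g)"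
  by (induction I rule: infinite_finite_induct) (simp_all add: cr_coeff_zero cr_coeff_add)

lemma cr_coeff_sum_monomial:
  assumes "finite S" "0 \<notin> S"
  shows "cr_coeff (\<Sum>g\<in>S. cr_monomial (a g) g) k = (if k \<in> S then a k else 0)"
proof -
  have "cr_coeff (\<Sum>g\<in>S. cr_monomial (a g) g) k = (\<Sum>g\<in>S. if k = g then a g else 0)"
    unfolding cr_coeff_sum cr_coeff_monomial using assms by (intro sum.cong) auto
  then show ?thesis using assms by simp
qed

lemma cr_expansion: "x = (\<Sum>g | cr_coeff x g \<noteq> 0. cr_monomial (cr_coeff x g) g)"
proof -
  have "0 \<notin> {g. cr_coeff x g \<noteq> 0}"
    by transfer simp
  from cr_coeff_sum_monomial[OF finite_cr_coeff this, of "cr_coeff x"]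
  have "cr_coeff (\<Sum>g | cr_coeff x g \<noteq> 0. cr_monomial (cr_coeff x g) g) = cr_coeff x"
    by (simp add: fun_eq_iff)
  then show ?thesis by (simp only: cr_coeff_inject)
qed

definition induced_trace ::
  "('c::ring \<Rightarrow> 'r::comm_monoid_add \<Rightarrow> 'r) \<Rightarrow> ('g::zero \<Rightarrow> 'r) \<Rightarrow> ('c, 'g) contracted_ring \<Rightarrow> 'r" where
  "induced_trace scale \<delta> x = (\<Sum>g | cr_coeff x g \<noteq> 0. scale (cr_coeff x g) (\<delta> g))"

lemma (in algebra_over) induced_trace_sum_monomial:
  assumes "finite S" "0 \<notin> S"
  shows "induced_trace scale \<delta> (\<Sum>g\<in>S. cr_monomial (a g) g) = (\<Sum>g\<in>S. scale (a g) (\<delta> g))"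
proof -
  have "scale 0 x = 0" for x
    using scale_add_left[of 0 0 x] by simp
  then show ?thesis
    unfolding induced_trace_def cr_coeff_sum_monomial[OF assms]
    using assms by (intro sum.mono_neutral_cong_left) auto
qed

end

theory Submission
  imports Defs HOL.Modules
begin

text \<open>
  The map \<open>t\<^sub>\<delta>\<close> is additive, so the trace identity only has to be checked on monomials, where it
  reads \<open>(c d) \<delta>(g h) = (d c) \<delta>(h g)\<close>. Conversely, a linear trace \<open>t\<close> is determined by its values
  \<open>\<delta>(g) = t(1 g)\<close>, and it is multiplicativity of monomials that makes \<open>\<delta>\<close> central.
\<close>

lemma monomial_mult:
  fixes c d :: "'c::ring" and g h :: "'g::semigroup_mult"
  shows "monomial c g * monomial d h = monomial (c * d) (g * h)"
proof (rule semigroup_ring_eqI)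
  fix k
  \<comment> \<open>Only inclusions are claimed: the supports are empty when \<open>c\<close> or
    \<open>d\<close> is zero. Over these singletons the double sum has a single term.\<close>
  have "{l. coeff (monomial c g) l \<noteq> 0} \<subseteq> {g}" "{l. coeff (monomial d h) l \<noteq> 0} \<subseteq> {h}"
    by (auto simp: monomial.rep_eq)
  from coeff_mult_eq[OF _ _ this, of k]
  show "coeff (monomial c g * monomial d h) k = coeff (monomial (c * d) (g * h)) k"
    by (auto simp: monomial.rep_eq)
qed

lemma cr_monomial_mult:
  fixes c d :: "'c::ring" and g h :: "'g::{semigroup_mult,mult_zero}"
  shows "cr_monomial c g * cr_monomial d h = cr_monomial (c * d) (g * h)"
  by transfer (simp add: contract_rel_iff monomial_mult)

lemma cr_scale_monomial: "cr_scale c (cr_monomial d g) = cr_monomial (c * d) g"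
  by transfer (simp add: contract_rel_iff sr_scale.rep_eq monomial.rep_eq)

text \<open>This is the contraction itself: \<open>cr_coeff\<close> discards the coefficient at the
  zero of the semigroup. It covers the products with \<open>g * h = 0\<close>.\<close>

lemma cr_monomial_at_zero: "cr_monomial c 0 = 0"
  by (subst cr_coeff_inject[symmetric]) (auto simp: fun_eq_iff cr_coeff_monomial cr_coeff_zero)

lemma cr_coeff_scale: "cr_coeff (cr_scale c x) g = c * cr_coeff x g"
  by transfer (simp add: sr_scale.rep_eq)

text \<open>Distributivity applied to the expansions of both factors. The products
  \<open>g * h\<close> may coincide or be zero, so this is not the normal form of
  \<open>x * y\<close>.\<close>

lemma cr_mult_expansion:
  fixes x y :: "('c::ring, 'g::{semigroup_mult,mult_zero}) contracted_ring"
  shows "x * y = (\<Sum>g | cr_coeff x g \<noteq> 0. \<Sum>h | cr_coeff y h \<noteq> 0.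
    cr_monomial (cr_coeff x g * cr_coeff y h) (g * h))"
proof -
  have "x * y = (\<Sum>g | cr_coeff x g \<noteq> 0. cr_monomial (cr_coeff x g) g) *
      (\<Sum>h | cr_coeff y h \<noteq> 0. cr_monomial (cr_coeff y h) h)"
    by (simp flip: cr_expansion)
  then show ?thesis
    by (simp add: sum_product cr_monomial_mult)
qed

context algebra_over
begin

lemma scale_zero_left: "scale 0 x = 0"
  using scale_add_left[of 0 0 x] by simp

lemma scale_zero_right: "scale c 0 = 0"
  using scale_add_right[of c 0 0] by simp

text \<open>The index set in \<open>induced_trace\<close> depends on the element. Summing over a
  larger finite set only adds terms with coefficient 0, so several elements can share one index
  set.\<close>

lemma induced_trace_superset:
  assumes "finite S" "{g. cr_coeff x g \<noteq> 0} \<subseteq> S"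
  shows "induced_trace scale \<delta> x = (\<Sum>g\<in>S. scale (cr_coeff x g) (\<delta> g))"
  unfolding induced_trace_def
  using assms by (intro sum.mono_neutral_left) (auto simp: scale_zero_left)

lemma additive_induced_trace:
  fixes \<delta> :: "'g::zero \<Rightarrow> 'r"
  shows "additive (induced_trace scale \<delta>)"
proof
  fix x y :: "('c, 'g) contracted_ring"
  define S where "S = {g. cr_coeff x g \<noteq> 0} \<union> {g. cr_coeff y g \<noteq> 0}"
  have S: "finite S" "{g. cr_coeff x g \<noteq> 0} \<subseteq> S" "{g. cr_coeff y g \<noteq> 0} \<subseteq> S"
    "{g. cr_coeff (x + y) g \<noteq> 0} \<subseteq> S"
    by (auto simp: S_def finite_cr_coeff cr_coeff_add)
  show "induced_trace scale \<delta> (x + y) = induced_trace scale \<delta> x + induced_trace scale \<delta> y"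
    using S by (simp add: induced_trace_superset[of S] cr_coeff_add scale_add_left sum.distrib)
qed

lemma induced_trace_monomial:
  assumes "preserves_zero \<delta>"
  shows "induced_trace scale \<delta> (cr_monomial c g) = scale c (\<delta> g)"
\<comment> \<open>For \<open>g = 0\<close> the monomial is zero in the contracted ring, so the
  formula forces \<open>scale c (\<delta> 0) = 0\<close>; this is where
  \<open>\<delta> 0 = 0\<close> enters.\<close>
proof (cases "g = 0")
  case True
  then show ?thesis
    using assms additive.zero[OF additive_induced_trace]
    by (simp add: cr_monomial_at_zero preserves_zero_def scale_zero_right)
next
  case False
  then show ?thesis
    using induced_trace_sum_monomial[of "{g}" \<delta> "\<lambda>_. c"] by simp
qed

lemma induced_trace_mult:
  fixes \<delta> :: "'g::{semigroup_mult,mult_zero} \<Rightarrow> 'r"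
  assumes "preserves_zero \<delta>"
  shows "induced_trace scale \<delta> (x * y) = (\<Sum>g | cr_coeff x g \<noteq> 0. \<Sum>h | cr_coeff y h \<noteq> 0.
    scale (cr_coeff x g * cr_coeff y h) (\<delta> (g * h)))"
  by (simp add: cr_mult_expansion additive.sum[OF additive_induced_trace]
      induced_trace_monomial[OF assms])

lemma is_trace_induced_trace:
  fixes \<delta> :: "'g::{semigroup_mult,mult_zero} \<Rightarrow> 'r"
  assumes "is_central \<delta>" "preserves_zero \<delta>"
  shows "is_trace (induced_trace scale \<delta>)"
  unfolding is_trace_def
proof (intro conjI allI)
  fix x y
  show "induced_trace scale \<delta> (x + y) = induced_trace scale \<delta> x + induced_trace scale \<delta> y"
    by (rule additive.add[OF additive_induced_trace])
  have "induced_trace scale \<delta> (x * y) = (\<Sum>h | cr_coeff y h \<noteq> 0. \<Sum>g | cr_coeff x g \<noteq> 0.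
      scale (cr_coeff x g * cr_coeff y h) (\<delta> (g * h)))"
    unfolding induced_trace_mult[OF assms(2)] by (rule sum.swap)
  \<comment> \<open>After the exchange of sums the two sides agree term by term: coefficients
    commute in the base ring, and \<open>\<delta> (g * h) = \<delta> (h * g)\<close>.\<close>
  also have "\<dots> = induced_trace scale \<delta> (y * x)"
    unfolding induced_trace_mult[OF assms(2)]
    using assms(1) by (intro sum.cong refl) (metis is_central_def mult.commute)
  finally show "induced_trace scale \<delta> (x * y) = induced_trace scale \<delta> (y * x)" .
qed

lemma scale_sum: "scale c (\<Sum>i\<in>I. f i) = (\<Sum>i\<in>I. scale c (f i))"
  by (rule additive.sum[of "scale c"]) (simp add: additive_def scale_add_right)

lemma scale_linear_induced_trace:
  fixes \<delta> :: "'g::zero \<Rightarrow> 'r"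
  shows "scale_linear cr_scale scale (induced_trace scale \<delta>)"
  unfolding scale_linear_def
proof (intro allI)
  fix c and x :: "('c, 'g) contracted_ring"
  \<comment> \<open>The inclusion can be strict, since \<open>c\<close> may annihilate a nonzero
    coefficient; both traces are therefore summed over the support of \<open>x\<close>.\<close>
  have "{g. cr_coeff (cr_scale c x) g \<noteq> 0} \<subseteq> {g. cr_coeff x g \<noteq> 0}"
    by (auto simp: cr_coeff_scale)
  from induced_trace_superset[OF finite_cr_coeff this]
  show "induced_trace scale \<delta> (cr_scale c x) = scale c (induced_trace scale \<delta> x)"
    by (simp add: induced_trace_def cr_coeff_scale scale_sum scale_scale)
qed

end

lemma is_trace_additive: "is_trace t \<Longrightarrow> additive t"
  by (simp add: is_trace_def additive_def)

text \<open>Since \<open>e * e = e\<close>, the map sending \<open>g\<close> to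
  \<open>cr_monomial e g\<close> is multiplicative, and the trace identity pulls back along
  it.\<close>

lemma is_central_trace_monomial:
  fixes t :: "('c::ring, 'g::{semigroup_mult,mult_zero}) contracted_ring \<Rightarrow> 'r::ring"
  assumes "is_unity e" "is_trace t"
  shows "is_central (\<lambda>g. t (cr_monomial e g))"
  unfolding is_central_def
proof (intro allI)
  fix g h :: 'g
  have monomial_eq: "cr_monomial e (a * b) = cr_monomial e a * cr_monomial e b" for a b :: 'g
    using assms(1) by (simp add: cr_monomial_mult is_unity_def)
  show "t (cr_monomial e (g * h)) = t (cr_monomial e (h * g))"
    unfolding monomial_eq using assms(2) by (simp add: is_trace_def)
qed

lemma preserves_zero_additive_monomial:
  "additive t \<Longrightarrow> preserves_zero (\<lambda>g. t (cr_monomial c g))"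
  by (simp add: preserves_zero_def cr_monomial_at_zero additive.zero)

text \<open>Each monomial is \<open>cr_scale c (cr_monomial e g)\<close> because
  \<open>c * e = c\<close>. Linearity thus fixes \<open>t\<close> on monomials, and additivity
  extends this to their finite sums.\<close>

lemma additive_linear_eq_induced_trace:
  fixes t :: "('c::comm_ring, 'g::zero) contracted_ring \<Rightarrow> 'r::ring"
  assumes "is_unity e" "additive t" "scale_linear cr_scale scale t"
  shows "t = induced_trace scale (\<lambda>g. t (cr_monomial e g))"
proof
  fix x
  have "t (cr_monomial c g) = scale c (t (cr_monomial e g))" for c g
    using assms(1,3) cr_scale_monomial[of c e g] unfolding scale_linear_def is_unity_def by metis
  then have "induced_trace scale (\<lambda>g. t (cr_monomial e g)) x =
      (\<Sum>g | cr_coeff x g \<noteq> 0. t (cr_monomial (cr_coeff x g) g))"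
    unfolding induced_trace_def by metis
  also have "\<dots> = t x"
    \<comment> \<open>Additivity moves \<open>t\<close> outside the sum, whose argument then folds
      back into \<open>x\<close>.\<close>
    by (simp flip: additive.sum[OF assms(2)] cr_expansion)
  finally show "t x = induced_trace scale (\<lambda>g. t (cr_monomial e g)) x" ..
qed

theorem proposition3:
  fixes scale :: "'c::comm_ring \<Rightarrow> 'r::ring \<Rightarrow> 'r"
  assumes "algebra_over scale"
  shows "(\<forall>\<delta> :: 'g::{semigroup_mult,mult_zero} \<Rightarrow> 'r.
            is_central \<delta> \<and> preserves_zero \<delta> \<longrightarrow>
              is_trace (induced_trace scale \<delta>) \<and>
              scale_linear cr_scale scale (induced_trace scale \<delta>)) \<and>
         ((\<exists>e::'c. is_unity e) \<longrightarrow>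
            (\<forall>t :: ('c, 'g) contracted_ring \<Rightarrow> 'r.
               is_trace t \<and> scale_linear cr_scale scale t \<longrightarrow>
                 (\<exists>\<delta> :: 'g \<Rightarrow> 'r.
                    is_central \<delta> \<and> preserves_zero \<delta> \<and> t = induced_trace scale \<delta>)))"
proof (intro conjI allI impI)
  interpret algebra_over scale by (rule assms)
  fix \<delta> :: "'g \<Rightarrow> 'r"
  assume "is_central \<delta> \<and> preserves_zero \<delta>"
  then show "is_trace (induced_trace scale \<delta>)"
    by (simp add: is_trace_induced_trace)
  show "scale_linear cr_scale scale (induced_trace scale \<delta>)"
    by (rule scale_linear_induced_trace)
next
  fix t :: "('c, 'g) contracted_ring \<Rightarrow> 'r"
  assume "\<exists>e::'c. is_unity e" and t: "is_trace t \<and> scale_linear cr_scale scale t"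
  then obtain e :: 'c where "is_unity e"
    by blast
  \<comment> \<open>The witness is \<open>\<lambda>g. t (cr_monomial e g)\<close>.\<close>
  with t show "\<exists>\<delta>. is_central \<delta> \<and> preserves_zero \<delta> \<and> t = induced_trace scale \<delta>"
    by (meson is_central_trace_monomial preserves_zero_additive_monomial
        additive_linear_eq_induced_trace is_trace_additive)
qed

end
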